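(* Consider sequences generated by the iTRDH algorithm described in the context. Assume that there is $d_{\max}>0$ with $\|d_k\|_\infty\le d_{\max}$ for all $k\in\mathbb{N}$, set $\nu_{\min}:=1/(d_{\max}+\alpha^{-1})$, and assume that there exist $\kappa_{\mathrm{m}}>0$ and $\kappa_{\mathrm{mdc}}\in(0,1)$ such that for all $k$, $$|f(x_k+s_k)+h(x_k+s_k)-m(s_k;x_k,D_k)|\le\kappa_{\mathrm{m}}\|s_k\|^2,\qquad \xi(\Delta_k;x_k,D_k)\ge\kappa_{\mathrm{mdc}}\,\xi_{\mathrm{cp}}(\Delta_k;x_k,\nu_k).$$ Assume that the algorithm generates infinitely many successful iterations (iterations with $\rho_k\ge\eta_1$) and that there exists $(f+h)_{\mathrm{low}}\in\mathbb{R}$ such that $(f+h)(x_k)\ge(f+h)_{\mathrm{low}}$ for all $k\in\mathbb{N}$. Let $\epsilon\in(0,1)$ and $$S(\epsilon):=\{k\in\mathbb{N}\ :\ \nu_k^{-1/2}\xi(\Delta_k;x_k,D_k)^{1/2}>\epsilon\ \text{and}\ \rho_k\ge\eta_1\}.$$ Then $$|S(\epsilon)|\le\frac{(f+h)(x_0)-(f+h)_{\mathrm{low}}}{\eta_1\,\nu_{\min}\,\epsilon^2}.$$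
   Context: Problem: minimize $f(x)+h(x)$ subject to $\ell\le x\le u$, where $\ell\in(\mathbb{R}\cup\{-\infty\})^n$, $u\in(\mathbb{R}\cup\{+\infty\})^n$, $\ell\le u$ componentwise, $f:\mathbb{R}^n\to\mathbb{R}$ is continuously differentiable on an open set containing $[\ell,u]$, and $h:\mathbb{R}^n\to\mathbb{R}\cup\{+\infty\}$ is proper and lower semicontinuous. $\chi(\cdot\mid A)$ is the indicator of $A$ ($0$ on $A$, $+\infty$ elsewhere). $\|\cdot\|$ is the norm defining the trust region, and $\mathbb{B}$ is its closed unit ball. $|S|$ denotes the cardinality of a set $S$. For $x$ with $h(x)$ finite, $\psi(\cdot;x)$ is a model of $s\mapsto h(x+s)$ that is proper, lower semicontinuous, with $\psi(0;x)=h(x)$ and $\partial\psi(0;x)=\partial h(x)$ ($\partial$ is the limiting subdifferential). For $\nu>0$ and $D$ diagonal, $\varphi_{\mathrm{cp}}(s;x):=f(x)+\nabla f(x)^Ts$, $m(s;x,\nu):=\varphi_{\mathrm{cp}}(s;x)+\tfrac12\nu^{-1}\|s\|_2^2+\psi(s;x)$, and $m(s;x,D):=\varphi_{\mathrm{cp}}(s;x)+\tfrac12s^TDs+\psi(s;x)$. iTRDH algorithm. Constants: $0<\eta_1\le\eta_2<1$, $0<1/\gamma_3\le\gamma_1\le\gamma_2<1<\gamma_3\le\gamma_4$, $\alpha>0$. Start from $x_0\in[\ell,u]$ with $h(x_0)$ finite, $\Delta_0>0$ and $d_0\in\mathbb{R}^n$. For $k=0,1,\dots$: set $D_k=\operatorname{diag}(d_k)$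 and $\nu_k:=1/(\|d_k\|_\infty+\alpha^{-1})$; compute $s_k\in\operatorname{argmin}_s\ m(s;x_k,D_k)+\chi(x_k+s\mid[\ell,u]\cap(x_k+\Delta_k\mathbb{B}))$; compute $$\rho_k:=\frac{f(x_k)+h(x_k)-(f(x_k+s_k)+h(x_k+s_k))}{m(0;x_k,D_k)-m(s_k;x_k,D_k)};$$ set $x_{k+1}=x_k+s_k$ if $\rho_k\ge\eta_1$ and $x_{k+1}=x_k$ otherwise; choose an arbitrary $d_{k+1}\in\mathbb{R}^n$; choose $\Delta_{k+1}\in[\gamma_3\Delta_k,\gamma_4\Delta_k]$ if $\rho_k\ge\eta_2$ (very successful), $\Delta_{k+1}\in[\gamma_2\Delta_k,\Delta_k]$ if $\eta_1\le\rho_k<\eta_2$ (successful), $\Delta_{k+1}\in[\gamma_1\Delta_k,\gamma_2\Delta_k]$ if $\rho_k<\eta_1$ (unsuccessful). Model decreases: $\xi(\Delta_k;x_k,D_k):=f(x_k)+h(x_k)-m(s_k;x_k,D_k)$, and $\xi_{\mathrm{cp}}(\Delta_k;x_k,\nu_k):=f(x_k)+h(x_k)-(\varphi_{\mathrm{cp}}(s_{k,1};x_k)+\psi(s_{k,1};x_k))$, where $s_{k,1}\in\operatorname{argmin}_s\ m(s;x_k,\nu_k)+\chi(x_k+s\mid[\ell,u]\cap(x_k+\Delta_k\mathbb{B}))$ (used only in the analysis). It is understood that $\xi(\Delta_k;x_k,D_k)>0$ at every iteration, so that $\rho_k$ is well defined. *)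

theory Defs
  imports "HOL-Analysis.Analysis"
begin

definition proper_fun :: "('a \<Rightarrow> ereal) \<Rightarrow> bool" where
  "proper_fun g \<longleftrightarrow> (\<forall>x. g x \<noteq> - \<infinity>) \<and> (\<exists>x. g x \<noteq> \<infinity>)"

definition lsc :: "('a::topological_space \<Rightarrow> ereal) \<Rightarrow> bool" where
  "lsc g \<longleftrightarrow> (\<forall>x. g x \<le> Liminf (nhds x) g)"

definition indicator_ext :: "'a \<Rightarrow> 'a set \<Rightarrow> ereal" where
  "indicator_ext x A = (if x \<in> A then 0 else \<infinity>)"

text \<open>Regular (Frechet) subdifferential: $v$ belongs to it iff
  $g(y) \ge g(x) + v^T(y - x) + o(\|y - x\|)$. The filter \<^term>\<open>at x\<close> excludes \<^term>\<open>y = x\<close>.\<close>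

definition regular_subdifferential :: "('a::euclidean_space \<Rightarrow> ereal) \<Rightarrow> 'a \<Rightarrow> 'a set" where
  "regular_subdifferential g x =
     {v. \<bar>g x\<bar> \<noteq> \<infinity> \<and>
         0 \<le> Liminf (at x) (\<lambda>y. (g y - g x - ereal (v \<bullet> (y - x))) / ereal (norm (y - x)))}"

definition limiting_subdifferential :: "('a::euclidean_space \<Rightarrow> ereal) \<Rightarrow> 'a \<Rightarrow> 'a set" where
  "limiting_subdifferential g x =
     {v. \<bar>g x\<bar> \<noteq> \<infinity> \<and>
         (\<exists>y w. y \<longlonglongrightarrow> x \<and> (\<lambda>n. g (y n)) \<longlonglongrightarrow> g x \<and>
                (\<forall>n. w n \<in> regular_subdifferential g (y n)) \<and> w \<longlonglongrightarrow> v)}"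

definition gradient :: "('a::euclidean_space \<Rightarrow> real) \<Rightarrow> 'a \<Rightarrow> 'a" where
  "gradient f x = (THE g. GDERIV f x :> g)"

lemma GDERIV_gradient:
  assumes "f differentiable (at x)"
  shows "GDERIV f x :> gradient f x"
proof -
  obtain D where D: "(f has_derivative D) (at x)"
    using assms by (auto simp: differentiable_def)
  have "linear D"
    using D has_derivative_linear by blast
  then have "(\<lambda>h. h \<bullet> adjoint D 1) = D"
    using adjoint_works[of D _ 1] by (simp add: fun_eq_iff)
  with D have ex: "GDERIV f x :> adjoint D 1"
    unfolding gderiv_def by simp
  show ?thesis
    unfolding gradient_def
  proof (rule theI[where P = "\<lambda>g. GDERIV f x :> g", OF ex])
    fix g assume g: "GDERIV f x :> g"
    have "(\<lambda>h. h \<bullet> g) = (\<lambda>h. h \<bullet> adjoint D 1)"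
      by (rule has_derivative_unique[OF g[unfolded gderiv_def] ex[unfolded gderiv_def]])
    then have "\<forall>h. h \<bullet> g = h \<bullet> adjoint D 1"
      by (rule fun_cong[THEN allI])
    then show "g = adjoint D 1"
      by (simp only: vector_eq_ldot)
  qed
qed

definition continuously_differentiable_on :: "('a::euclidean_space \<Rightarrow> real) \<Rightarrow> 'a set \<Rightarrow> bool" where
  "continuously_differentiable_on f U \<longleftrightarrow>
     (\<forall>x\<in>U. f differentiable (at x)) \<and> continuous_on U (gradient f)"

definition is_norm :: "('a::real_vector \<Rightarrow> real) \<Rightarrow> bool" where
  "is_norm N \<longleftrightarrow>
     (\<forall>x. N x = 0 \<longleftrightarrow> x = 0) \<and> (\<forall>c x. N (c *\<^sub>R x) = \<bar>c\<bar> * N x) \<and>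
     (\<forall>x y. N (x + y) \<le> N x + N y)"

definition box_set :: "ereal ^ 'n \<Rightarrow> ereal ^ 'n \<Rightarrow> (real ^ 'n) set" where
  "box_set l u = {x. \<forall>i. l $ i \<le> ereal (x $ i) \<and> ereal (x $ i) \<le> u $ i}"

definition trust_region :: "('a::real_vector \<Rightarrow> real) \<Rightarrow> 'a \<Rightarrow> real \<Rightarrow> 'a set" where
  "trust_region N x r = {x + r *\<^sub>R z | z. N z \<le> 1}"

definition diag :: "real ^ 'n \<Rightarrow> real ^ 'n ^ 'n" where
  "diag d = (\<chi> i j. if i = j then d $ i else 0)"

text \<open>In what follows \<open>\<psi> x\<close> is the model $s \mapsto \psi(s; x)$ of $s \mapsto h(x+s)$; in all
  models the base point precedes the step.\<close>

definition phi_cp :: "(real ^ 'n \<Rightarrow> real) \<Rightarrow> real ^ 'n \<Rightarrow> real ^ 'n \<Rightarrow> real" where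
  "phi_cp f x s = f x + gradient f x \<bullet> s"

definition model_nu ::
  "(real ^ 'n \<Rightarrow> real) \<Rightarrow> (real ^ 'n \<Rightarrow> real ^ 'n \<Rightarrow> ereal) \<Rightarrow>
   real ^ 'n \<Rightarrow> real \<Rightarrow> real ^ 'n \<Rightarrow> ereal" where
  "model_nu f \<psi> x \<nu> s = ereal (phi_cp f x s + 1/2 * inverse \<nu> * (norm s)\<^sup>2) + \<psi> x s"

definition model_D ::
  "(real ^ 'n \<Rightarrow> real) \<Rightarrow> (real ^ 'n \<Rightarrow> real ^ 'n \<Rightarrow> ereal) \<Rightarrow>
   real ^ 'n \<Rightarrow> real ^ 'n ^ 'n \<Rightarrow> real ^ 'n \<Rightarrow> ereal" where
  "model_D f \<psi> x D s = ereal (phi_cp f x s + 1/2 * (s \<bullet> (D *v s))) + \<psi> x s"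

definition objective :: "('a \<Rightarrow> real) \<Rightarrow> ('a \<Rightarrow> ereal) \<Rightarrow> 'a \<Rightarrow> ereal" where
  "objective f h x = ereal (f x) + h x"

definition xi ::
  "(real ^ 'n \<Rightarrow> real) \<Rightarrow> (real ^ 'n \<Rightarrow> ereal) \<Rightarrow> (real ^ 'n \<Rightarrow> real ^ 'n \<Rightarrow> ereal) \<Rightarrow>
   real ^ 'n \<Rightarrow> real ^ 'n ^ 'n \<Rightarrow> real ^ 'n \<Rightarrow> ereal" where
  "xi f h \<psi> x D s = objective f h x - model_D f \<psi> x D s"

text \<open>The decrease \<open>xi_cp\<close> leaves out the quadratic term of \<^const>\<open>model_nu\<close>; $\nu$ enters only
  through the step, which is a minimizer of \<^const>\<open>model_nu\<close>.\<close>

definition xi_cp ::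
  "(real ^ 'n \<Rightarrow> real) \<Rightarrow> (real ^ 'n \<Rightarrow> ereal) \<Rightarrow> (real ^ 'n \<Rightarrow> real ^ 'n \<Rightarrow> ereal) \<Rightarrow>
   real ^ 'n \<Rightarrow> real ^ 'n \<Rightarrow> ereal" where
  "xi_cp f h \<psi> x s1 = objective f h x - (ereal (phi_cp f x s1) + \<psi> x s1)"

definition rho ::
  "(real ^ 'n \<Rightarrow> real) \<Rightarrow> (real ^ 'n \<Rightarrow> ereal) \<Rightarrow> (real ^ 'n \<Rightarrow> real ^ 'n \<Rightarrow> ereal) \<Rightarrow>
   real ^ 'n \<Rightarrow> real ^ 'n ^ 'n \<Rightarrow> real ^ 'n \<Rightarrow> ereal" where
  "rho f h \<psi> x D s =
     (objective f h x - objective f h (x + s)) / (model_D f \<psi> x D 0 - model_D f \<psi> x D s)"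

definition nu :: "real \<Rightarrow> real ^ 'n \<Rightarrow> real" where
  "nu \<alpha> d = 1 / (infnorm d + inverse \<alpha>)"

locale composite_problem =
  fixes l u :: "ereal ^ 'n"
    and f :: "real ^ 'n \<Rightarrow> real"
    and h :: "real ^ 'n \<Rightarrow> ereal"
    and \<psi> :: "real ^ 'n \<Rightarrow> real ^ 'n \<Rightarrow> ereal"
  assumes l_not_PInf: "\<And>i. l $ i \<noteq> \<infinity>"
    and u_not_MInf: "\<And>i. u $ i \<noteq> - \<infinity>"
    and l_le_u: "\<And>i. l $ i \<le> u $ i"
    and f_C1: "\<exists>U. open U \<and> box_set l u \<subseteq> U \<and> continuously_differentiable_on f U"
    and h_proper: "proper_fun h"
    and h_lsc: "lsc h"
    and psi_proper: "\<And>x. \<bar>h x\<bar> \<noteq> \<infinity> \<Longrightarrow> proper_fun (\<psi> x)"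
    and psi_lsc: "\<And>x. \<bar>h x\<bar> \<noteq> \<infinity> \<Longrightarrow> lsc (\<psi> x)"
    and psi_zero: "\<And>x. \<bar>h x\<bar> \<noteq> \<infinity> \<Longrightarrow> \<psi> x 0 = h x"
    and psi_subdifferential: "\<And>x. \<bar>h x\<bar> \<noteq> \<infinity> \<Longrightarrow>
          limiting_subdifferential (\<psi> x) 0 = limiting_subdifferential h x"

locale iTRDH = composite_problem l u f h \<psi>
  for l u :: "ereal ^ 'n"
    and f :: "real ^ 'n \<Rightarrow> real"
    and h :: "real ^ 'n \<Rightarrow> ereal"
    and \<psi> :: "real ^ 'n \<Rightarrow> real ^ 'n \<Rightarrow> ereal" +
  fixes N :: "real ^ 'n \<Rightarrow> real"
    and \<eta>1 \<eta>2 \<gamma>1 \<gamma>2 \<gamma>3 \<gamma>4 \<alpha> :: real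
    and x s d :: "nat \<Rightarrow> real ^ 'n"
    and \<Delta> :: "nat \<Rightarrow> real"
  assumes tr_norm: "is_norm N"
    and eta: "0 < \<eta>1" "\<eta>1 \<le> \<eta>2" "\<eta>2 < 1"
    and gamma: "0 < 1 / \<gamma>3" "1 / \<gamma>3 \<le> \<gamma>1" "\<gamma>1 \<le> \<gamma>2" "\<gamma>2 < 1" "1 < \<gamma>3" "\<gamma>3 \<le> \<gamma>4"
    and alpha_pos: "0 < \<alpha>"
    and x0_feasible: "x 0 \<in> box_set l u"
    and h_x0_finite: "\<bar>h (x 0)\<bar> \<noteq> \<infinity>"
    and Delta0_pos: "0 < \<Delta> 0"
    and step: "\<And>k. is_arg_min
          (\<lambda>s. model_D f \<psi> (x k) (diag (d k)) s +
                indicator_ext (x k + s) (box_set l u \<inter> trust_region N (x k) (\<Delta> k)))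
          (\<lambda>_. True) (s k)"
    and decrease_pos: "\<And>k. xi f h \<psi> (x k) (diag (d k)) (s k) > 0"
    and accept: "\<And>k. rho f h \<psi> (x k) (diag (d k)) (s k) \<ge> ereal \<eta>1 \<Longrightarrow> x (Suc k) = x k + s k"
    and reject: "\<And>k. rho f h \<psi> (x k) (diag (d k)) (s k) < ereal \<eta>1 \<Longrightarrow> x (Suc k) = x k"
    and radius_very_successful: "\<And>k. rho f h \<psi> (x k) (diag (d k)) (s k) \<ge> ereal \<eta>2 \<Longrightarrow>
          \<Delta> (Suc k) \<in> {\<gamma>3 * \<Delta> k .. \<gamma>4 * \<Delta> k}"
    and radius_successful: "\<And>k. ereal \<eta>1 \<le> rho f h \<psi> (x k) (diag (d k)) (s k) \<Longrightarrow>
          rho f h \<psi> (x k) (diag (d k)) (s k) < ereal \<eta>2 \<Longrightarrow>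
          \<Delta> (Suc k) \<in> {\<gamma>2 * \<Delta> k .. \<Delta> k}"
    and radius_unsuccessful: "\<And>k. rho f h \<psi> (x k) (diag (d k)) (s k) < ereal \<eta>1 \<Longrightarrow>
          \<Delta> (Suc k) \<in> {\<gamma>1 * \<Delta> k .. \<gamma>2 * \<Delta> k}"
begin

lemma model_finite:
  assumes "\<bar>h (x k)\<bar> \<noteq> \<infinity>"
  shows "\<bar>model_D f \<psi> (x k) (diag (d k)) (s k)\<bar> \<noteq> \<infinity>"
    and "model_D f \<psi> (x k) (diag (d k)) 0 = objective f h (x k)"
proof -
  have "\<psi> (x k) (s k) \<noteq> - \<infinity>"
    using psi_proper[OF assms] by (simp add: proper_fun_def)
  moreover have "\<psi> (x k) (s k) \<noteq> \<infinity>"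
    using decrease_pos[of k] assms
    by (cases "h (x k)") (auto simp: xi_def objective_def model_D_def)
  ultimately show "\<bar>model_D f \<psi> (x k) (diag (d k)) (s k)\<bar> \<noteq> \<infinity>"
    by (cases "\<psi> (x k) (s k)") (simp_all add: model_D_def)
  show "model_D f \<psi> (x k) (diag (d k)) 0 = objective f h (x k)"
    using psi_zero[OF assms] by (simp add: model_D_def phi_cp_def objective_def)
qed

lemma h_finite: "\<bar>h (x k)\<bar> \<noteq> \<infinity>"
proof (induction k)
  case 0
  show ?case by (rule h_x0_finite)
next
  case (Suc k)
  let ?rho = "rho f h \<psi> (x k) (diag (d k)) (s k)"
  show ?case
  proof (cases "ereal \<eta>1 \<le> ?rho")
    case True
    have "h (x k + s k) \<noteq> \<infinity>"
    proof
      assume inf: "h (x k + s k) = \<infinity>"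
      have "?rho = (objective f h (x k) - \<infinity>) / xi f h \<psi> (x k) (diag (d k)) (s k)"
        using inf model_finite(2)[OF Suc.IH] by (simp add: rho_def xi_def objective_def)
      moreover have "objective f h (x k) - \<infinity> = - \<infinity>"
        using Suc.IH by (cases "h (x k)") (auto simp: objective_def)
      ultimately have "?rho \<le> 0"
        using decrease_pos[of k]
        by (cases "xi f h \<psi> (x k) (diag (d k)) (s k)") (auto simp: divide_ereal_def)
      then show False
        using True eta(1) order.trans[of "ereal \<eta>1" ?rho 0] by simp
    qed
    moreover have "h (x k + s k) \<noteq> - \<infinity>"
      using h_proper by (simp add: proper_fun_def)
    ultimately show ?thesis
      unfolding accept[OF True] by (cases "h (x k + s k)") simp_all
  next
    case False
    then show ?thesis
      using reject[of k] Suc.IH by simp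
  qed
qed

lemma xi_finite: "\<bar>xi f h \<psi> (x k) (diag (d k)) (s k)\<bar> \<noteq> \<infinity>"
proof -
  obtain a where "h (x k) = ereal a"
    using h_finite[of k] by (cases "h (x k)") simp_all
  moreover obtain b where "model_D f \<psi> (x k) (diag (d k)) (s k) = ereal b"
    using model_finite(1)[OF h_finite[of k]]
    by (cases "model_D f \<psi> (x k) (diag (d k)) (s k)") simp_all
  ultimately show ?thesis
    by (simp add: xi_def objective_def)
qed

end

text \<open>The set $S(\epsilon)$. Applying \<^const>\<open>real_of_ereal\<close> loses nothing, by
  \<open>iTRDH.xi_finite\<close>.\<close>

definition S_eps ::
  "(real ^ 'n \<Rightarrow> real) \<Rightarrow> (real ^ 'n \<Rightarrow> ereal) \<Rightarrow> (real ^ 'n \<Rightarrow> real ^ 'n \<Rightarrow> ereal) \<Rightarrow>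
   real \<Rightarrow> real \<Rightarrow> (nat \<Rightarrow> real ^ 'n) \<Rightarrow> (nat \<Rightarrow> real ^ 'n) \<Rightarrow> (nat \<Rightarrow> real ^ 'n) \<Rightarrow>
   real \<Rightarrow> nat set" where
  "S_eps f h \<psi> \<eta>1 \<alpha> x s d \<epsilon> =
     {k. nu \<alpha> (d k) powr (- 1/2) *
           real_of_ereal (xi f h \<psi> (x k) (diag (d k)) (s k)) powr (1/2) > \<epsilon> \<and>
         rho f h \<psi> (x k) (diag (d k)) (s k) \<ge> ereal \<eta>1}"

end

theory Submission
  imports Defs
begin

text \<open>The bound is a telescoping argument. The objective values along the iterates never increase
  (\<open>objective_value_antimono\<close>), because a rejected step leaves the iterate unchanged and an accepted one
  realizes at least the fraction \<open>\<eta>1\<close> of the model decrease, which is positive. An iteration that is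
  accepted while the criticality measure $\nu_k^{-1/2}\xi_k^{1/2}$ exceeds \<open>\<epsilon>\<close> has
  $\xi_k > \nu_k\epsilon^2 \ge \nu_{\min}\epsilon^2$, since a bound on \<open>d\<close> bounds $\nu_k$ from below.
  So it lowers the objective by at least the fixed amount $\eta_1\nu_{\min}\epsilon^2$
  (\<open>objective_drop_on_S_eps\<close>). As the total decrease is at most the gap between the initial value and
  the lower bound, there is room for only finitely many such iterations, and dividing the gap by the
  amount gives the estimate (\<open>card_large_drops\<close>).\<close>

text \<open>Each drop uses up an amount \<open>c\<close> of the total decrease, and the other steps give nothing back.
  Counting the drops in an initial segment, which is a finite set, gives a bound that does not depend
  on the segment; such a uniform bound on the finite subsets of \<open>S\<close> also forces \<open>S\<close> to be finite.\<close>

lemma card_large_drops: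
  fixes F :: "nat \<Rightarrow> real"
  assumes mono: "\<And>k. F (Suc k) \<le> F k"
    and low: "\<And>k. L \<le> F k"
    and c: "0 < c"
    and drop: "\<And>k. k \<in> S \<Longrightarrow> c \<le> F k - F (Suc k)"
  shows "finite S" and "real (card S) \<le> (F 0 - L) / c"
proof -
  have segment: "c * real (card (S \<inter> {..<n})) \<le> F 0 - F n" for n
  proof (induction n)
    case 0
    show ?case by simp
  next
    case (Suc n)
    show ?case
    proof (cases "n \<in> S")
      case True
      then have "card (S \<inter> {..<Suc n}) = Suc (card (S \<inter> {..<n}))"
        by (simp add: lessThan_Suc)
      then have "c * real (card (S \<inter> {..<Suc n})) = c * real (card (S \<inter> {..<n})) + c"
        by (simp only: of_nat_Suc distrib_left mult_1_right add.commute)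
      then show ?thesis
        using Suc.IH drop[OF True] by linarith
    next
      case False
      then have "S \<inter> {..<Suc n} = S \<inter> {..<n}"
        by (simp add: lessThan_Suc)
      then have "c * real (card (S \<inter> {..<Suc n})) = c * real (card (S \<inter> {..<n}))"
        by (rule arg_cong)
      then show ?thesis
        using Suc.IH mono[of n] by linarith
    qed
  qed
  have bound: "real (card G) \<le> (F 0 - L) / c" if G: "finite G" "G \<subseteq> S" for G
  proof -
    obtain n where "G \<subseteq> {..<n}"
      using G(1) finite_nat_iff_bounded by blast
    with G have "card G \<le> card (S \<inter> {..<n})"
      by (intro card_mono) auto
    then have "c * real (card G) \<le> c * real (card (S \<inter> {..<n}))"
      using c by simp
    also have "\<dots> \<le> F 0 - L"
      using segment[of n] low[of n] by linarith
    finally show ?thesis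
      using c by (simp add: pos_le_divide_eq mult.commute)
  qed
  show "finite S"
  proof (rule ccontr)
    assume "infinite S"
    then obtain G where "finite G" "card G = Suc (nat \<lfloor>(F 0 - L) / c\<rfloor>)" "G \<subseteq> S"
      using infinite_arbitrarily_large by blast
    with bound[of G] show False
      by linarith
  qed
  then show "real (card S) \<le> (F 0 - L) / c"
    by (rule bound) simp
qed

lemma nu_bounded_below:
  assumes "0 < \<alpha>" and "infnorm d \<le> B"
  shows "1 / (B + inverse \<alpha>) \<le> nu \<alpha> d"
  unfolding nu_def using assms infnorm_pos_le[of d]
  by (intro divide_left_mono mult_pos_pos add_nonneg_pos) auto

lemma nu_pos:
  assumes "0 < \<alpha>"
  shows "0 < nu \<alpha> d"
  unfolding nu_def using assms infnorm_pos_le[of d]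
  by (intro divide_pos_pos add_nonneg_pos) auto

text \<open>The criticality measure is the square root of $\xi/\nu$.\<close>

lemma criticality_gt_imp:
  fixes \<nu> \<xi> \<epsilon> :: real
  assumes "0 < \<nu>" "0 \<le> \<xi>" "0 \<le> \<epsilon>"
    and "\<epsilon> < \<nu> powr (- 1/2) * \<xi> powr (1/2)"
  shows "\<nu> * \<epsilon>\<^sup>2 < \<xi>"
proof -
  have "\<nu> powr (- 1/2) = inverse (sqrt \<nu>)"
    using powr_minus[of \<nu> "1/2"] powr_half_sqrt[of \<nu>] assms(1) by simp
  moreover have "\<xi> powr (1/2) = sqrt \<xi>"
    using assms(2) by (rule powr_half_sqrt)
  ultimately have "\<nu> powr (- 1/2) * \<xi> powr (1/2) = sqrt (\<xi> / \<nu>)"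
    by (simp only: real_sqrt_divide) (simp only: divide_inverse mult.commute)
  with assms(4) have "\<epsilon> < sqrt (\<xi> / \<nu>)"
    by simp
  then have "\<epsilon>\<^sup>2 < \<xi> / \<nu>"
    using assms(3) real_less_rsqrt[of \<epsilon>] real_sqrt_less_iff[of "\<epsilon>\<^sup>2"]
    by (simp add: abs_of_nonneg)
  then show ?thesis
    using assms(1) by (simp add: pos_less_divide_eq mult.commute)
qed

lemma (in iTRDH) objective_finite:
  "objective f h (x k) = ereal (real_of_ereal (objective f h (x k)))"
  using h_finite[of k] by (cases "h (x k)") (simp_all add: objective_def)

text \<open>The denominator of the acceptance ratio is the model decrease, because the model agrees with the
  objective at the zero step; clearing it gives a sufficient decrease condition.\<close>

lemma (in iTRDH) successful_decrease:
  assumes "ereal \<eta>1 \<le> rho f h \<psi> (x k) (diag (d k)) (s k)"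
  shows "\<eta>1 * real_of_ereal (xi f h \<psi> (x k) (diag (d k)) (s k))
           \<le> real_of_ereal (objective f h (x k)) - real_of_ereal (objective f h (x (Suc k)))"
proof -
  obtain a where a: "objective f h (x k) = ereal a"
    using objective_finite by (rule that)
  obtain b where b: "objective f h (x k + s k) = ereal b"
    using objective_finite[of "Suc k", unfolded accept[OF assms]] by (rule that)
  obtain r where r: "xi f h \<psi> (x k) (diag (d k)) (s k) = ereal r"
    using xi_finite[of k] by (cases "xi f h \<psi> (x k) (diag (d k)) (s k)") simp_all
  have "0 < r"
    using decrease_pos[of k] r by simp
  have "rho f h \<psi> (x k) (diag (d k)) (s k)
          = (ereal a - ereal b) / xi f h \<psi> (x k) (diag (d k)) (s k)"
    unfolding rho_def xi_def model_finite(2)[OF h_finite] a b by (rule refl)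
  with assms r \<open>0 < r\<close> have "\<eta>1 \<le> (a - b) / r"
    by simp
  with \<open>0 < r\<close> show ?thesis
    by (simp add: accept[OF assms] a b r pos_le_divide_eq)
qed

lemma (in iTRDH) objective_value_antimono:
  "real_of_ereal (objective f h (x (Suc k))) \<le> real_of_ereal (objective f h (x k))"
proof (cases "ereal \<eta>1 \<le> rho f h \<psi> (x k) (diag (d k)) (s k)")
  case True
  have "0 \<le> \<eta>1 * real_of_ereal (xi f h \<psi> (x k) (diag (d k)) (s k))"
    using eta(1) decrease_pos[of k] by (simp add: real_of_ereal_pos less_imp_le)
  with successful_decrease[OF True] show ?thesis
    by linarith
next
  case False
  then show ?thesis
    using reject[of k] by simp
qed

lemma (in iTRDH) objective_drop_on_S_eps:
  assumes bounded: "infnorm (d k) \<le> d_max"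
    and "0 \<le> \<epsilon>"
    and mem: "k \<in> S_eps f h \<psi> \<eta>1 \<alpha> x s d \<epsilon>"
  shows "\<eta>1 * (1 / (d_max + inverse \<alpha>)) * \<epsilon>\<^sup>2
           \<le> real_of_ereal (objective f h (x k)) - real_of_ereal (objective f h (x (Suc k)))"
proof -
  let ?xi = "real_of_ereal (xi f h \<psi> (x k) (diag (d k)) (s k))"
  have crit: "\<epsilon> < nu \<alpha> (d k) powr (- 1/2) * ?xi powr (1/2)"
    and succ: "ereal \<eta>1 \<le> rho f h \<psi> (x k) (diag (d k)) (s k)"
    using mem by (simp_all add: S_eps_def)
  have "0 \<le> ?xi"
    using decrease_pos[of k] by (simp add: real_of_ereal_pos less_imp_le)
  have "1 / (d_max + inverse \<alpha>) * \<epsilon>\<^sup>2 \<le> nu \<alpha> (d k) * \<epsilon>\<^sup>2"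
    using nu_bounded_below[OF alpha_pos bounded] by (rule mult_right_mono) simp
  also have "\<dots> \<le> ?xi"
    using criticality_gt_imp[OF nu_pos[OF alpha_pos] \<open>0 \<le> ?xi\<close> \<open>0 \<le> \<epsilon>\<close> crit] by simp
  finally have "\<eta>1 * (1 / (d_max + inverse \<alpha>) * \<epsilon>\<^sup>2) \<le> \<eta>1 * ?xi"
    using eta(1) by (intro mult_left_mono) auto
  with successful_decrease[OF succ] show ?thesis
    by (simp only: mult.assoc)
qed

theorem lemma2:
  fixes l u :: "ereal ^ 'n"
    and f :: "real ^ 'n \<Rightarrow> real"
    and h :: "real ^ 'n \<Rightarrow> ereal"
    and \<psi> :: "real ^ 'n \<Rightarrow> real ^ 'n \<Rightarrow> ereal"
    and N :: "real ^ 'n \<Rightarrow> real"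
    and \<eta>1 \<eta>2 \<gamma>1 \<gamma>2 \<gamma>3 \<gamma>4 \<alpha> :: real
    and x s s1 d :: "nat \<Rightarrow> real ^ 'n"
    and \<Delta> :: "nat \<Rightarrow> real"
    and d_max \<nu>_min \<kappa>m \<kappa>mdc fh_low \<epsilon> :: real
  assumes "iTRDH l u f h \<psi> N \<eta>1 \<eta>2 \<gamma>1 \<gamma>2 \<gamma>3 \<gamma>4 \<alpha> x s d \<Delta>"
    and "\<And>k. is_arg_min
          (\<lambda>t. model_nu f \<psi> (x k) (nu \<alpha> (d k)) t +
                indicator_ext (x k + t) (box_set l u \<inter> trust_region N (x k) (\<Delta> k)))
          (\<lambda>_. True) (s1 k)"
    and "0 < d_max" and "\<And>k. infnorm (d k) \<le> d_max"
    and "\<nu>_min = 1 / (d_max + inverse \<alpha>)"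
    and "0 < \<kappa>m"
    and "\<And>k. \<bar>objective f h (x k + s k) - model_D f \<psi> (x k) (diag (d k)) (s k)\<bar>
               \<le> ereal (\<kappa>m * (N (s k))\<^sup>2)"
    and "0 < \<kappa>mdc" and "\<kappa>mdc < 1"
    and "\<And>k. xi f h \<psi> (x k) (diag (d k)) (s k) \<ge> ereal \<kappa>mdc * xi_cp f h \<psi> (x k) (s1 k)"
    and "infinite {k. rho f h \<psi> (x k) (diag (d k)) (s k) \<ge> ereal \<eta>1}"
    and "\<And>k. objective f h (x k) \<ge> ereal fh_low"
    and "0 < \<epsilon>" and "\<epsilon> < 1"
  shows "finite (S_eps f h \<psi> \<eta>1 \<alpha> x s d \<epsilon>) \<and>
         ereal (real (card (S_eps f h \<psi> \<eta>1 \<alpha> x s d \<epsilon>)))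
           \<le> (objective f h (x 0) - ereal fh_low) / ereal (\<eta>1 * \<nu>_min * \<epsilon>\<^sup>2)"
proof -
  interpret iTRDH l u f h \<psi> N \<eta>1 \<eta>2 \<gamma>1 \<gamma>2 \<gamma>3 \<gamma>4 \<alpha> x s d \<Delta>
    by (rule assms(1))
  define F where "F k = real_of_ereal (objective f h (x k))" for k
  have F: "objective f h (x k) = ereal (F k)" for k
    unfolding F_def by (rule objective_finite)
  have mono: "F (Suc k) \<le> F k" for k
    unfolding F_def by (rule objective_value_antimono)
  have low: "fh_low \<le> F k" for k
    using assms(12)[of k] by (simp add: F)
  have c: "0 < \<eta>1 * \<nu>_min * \<epsilon>\<^sup>2"
    using eta(1) alpha_pos \<open>0 < d_max\<close> \<open>0 < \<epsilon>\<close> by (simp add: assms(5) add_pos_pos)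
  have drop: "\<eta>1 * \<nu>_min * \<epsilon>\<^sup>2 \<le> F k - F (Suc k)" if "k \<in> S_eps f h \<psi> \<eta>1 \<alpha> x s d \<epsilon>" for k
    unfolding F_def assms(5)
    by (rule objective_drop_on_S_eps[OF assms(4) less_imp_le[OF \<open>0 < \<epsilon>\<close>] that])
  have "(objective f h (x 0) - ereal fh_low) / ereal (\<eta>1 * \<nu>_min * \<epsilon>\<^sup>2)
          = ereal ((F 0 - fh_low) / (\<eta>1 * \<nu>_min * \<epsilon>\<^sup>2))"
    unfolding F ereal_minus(1) ereal_divide by (rule if_not_P) (use c in linarith)
  then show ?thesis
    using card_large_drops[of F fh_low "\<eta>1 * \<nu>_min * \<epsilon>\<^sup>2" "S_eps f h \<psi> \<eta>1 \<alpha> x s d \<epsilon>",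
        OF mono low c drop]
    by (simp only: ereal_less_eq)
qed

end
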